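(* Let $n\ge1$, let $m=\lfloor n/2\rfloor$, and let $\mu^\ast$ be the matching of the cyclic Hollow-Shell $C_n$ given by $\mu^\ast(i)=i$ for $0\le i<m$, $\mu^\ast(m)=n-1$, and $\mu^\ast(i)=i-1$ for $m<i\le n-1$. The uniform distribution on the shift orbit $\{(\mu^\ast)^{\tau^t}:0\le t<n\}$ of $\mu^\ast$ has expected blocking count (in $C_n$) equal to $$\left\lfloor\frac{(n-1)^2}{4}\right\rfloor=\frac1n\sum_{i,j}\min(A_{ij},B_{ij}),$$ where $A,B$ are the rank-complement matrices of $C_n$.
   Context: Men and women are indexed by $\{0,\dots,n-1\}$, identified with $\mathbb{Z}/n\mathbb{Z}$; $\bmod\ n$ takes values in $\{0,\dots,n-1\}$. A complete matching is a bijection $\mu$ from men to women (a bijection of indices). A pair blocks $\mu$ if both members strictly prefer each other to their partners under $\mu$; the blocking count of $\mu$ is its number of blocking pairs. $r_M(g,h)$ is the rank (1 is best) of woman $h$ in man $g$'s list and $r_W(h,g)$ the rank of man $g$ in woman $h$'s list. The cyclic Hollow-Shell $C_n$ is the instance with $r_M(g,h)=((h-g)\bmod n)+1$ and $r_W(h,g)=n-((h-g)\bmod n)$. The rank-complement matrices are $A_{ij}=n-r_M(i,j)$ and $B_{ij}=n-r_W(j,i)$. The shift $\tau$ is $g\mapsto g+1$ on men and $h\mapsto h+1$ on women (mod $n$); it acts on matchings by $\mu^{\tau}(g)=\mu(g-1)+1$, so $\mu^{\tau^t}(g)=\mu(g-t)+t$ (indices mod $n$). *)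

theory Defs
  imports "HOL-Probability.Probability"
begin

text \<open>
  Indices modulo \<open>n\<close> are the integers in \<open>{0..<int n}\<close>, so that \<open>(h - g) mod int n\<close> is the
  residue in \<open>{0..<int n}\<close> without truncated subtraction. A matching is a function on that set;
  it is extensional (\<open>undefined\<close> outside), so that equal matchings are equal functions and a set
  of matchings has no spurious duplicates.
\<close>

abbreviation indices :: "nat \<Rightarrow> int set" where
  "indices n \<equiv> {0..<int n}"

definition complete_matching :: "nat \<Rightarrow> (int \<Rightarrow> int) \<Rightarrow> bool" where
  "complete_matching n \<mu> \<longleftrightarrow> \<mu> \<in> extensional (indices n) \<and> bij_betw \<mu> (indices n) (indices n)"

text \<open>
  An instance is given by its rank functions: \<open>rM g h\<close> is the rank of woman \<open>h\<close> in the list of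
  man \<open>g\<close>, and \<open>rW h g\<close> the rank of man \<open>g\<close> in the list of woman \<open>h\<close>; smaller is better.
\<close>

definition blocks ::
    "nat \<Rightarrow> (int \<Rightarrow> int \<Rightarrow> int) \<Rightarrow> (int \<Rightarrow> int \<Rightarrow> int) \<Rightarrow> (int \<Rightarrow> int) \<Rightarrow> int \<Rightarrow> int \<Rightarrow> bool" where
  "blocks n rM rW \<mu> g h \<longleftrightarrow>
     rM g h < rM g (\<mu> g) \<and> rW h g < rW h (inv_into (indices n) \<mu> h)"

definition blocking_count ::
    "nat \<Rightarrow> (int \<Rightarrow> int \<Rightarrow> int) \<Rightarrow> (int \<Rightarrow> int \<Rightarrow> int) \<Rightarrow> (int \<Rightarrow> int) \<Rightarrow> nat" where
  "blocking_count n rM rW \<mu> =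
     card {(g, h). g \<in> indices n \<and> h \<in> indices n \<and> blocks n rM rW \<mu> g h}"

definition man_complement :: "nat \<Rightarrow> (int \<Rightarrow> int \<Rightarrow> int) \<Rightarrow> int \<Rightarrow> int \<Rightarrow> int" where
  "man_complement n rM i j = int n - rM i j"

definition woman_complement :: "nat \<Rightarrow> (int \<Rightarrow> int \<Rightarrow> int) \<Rightarrow> int \<Rightarrow> int \<Rightarrow> int" where
  "woman_complement n rW i j = int n - rW j i"

definition hollow_shell_rM :: "nat \<Rightarrow> int \<Rightarrow> int \<Rightarrow> int" where
  "hollow_shell_rM n g h = (h - g) mod int n + 1"

definition hollow_shell_rW :: "nat \<Rightarrow> int \<Rightarrow> int \<Rightarrow> int" where
  "hollow_shell_rW n h g = int n - (h - g) mod int n"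

definition shift_matching :: "nat \<Rightarrow> (int \<Rightarrow> int) \<Rightarrow> int \<Rightarrow> int" where
  "shift_matching n \<mu> = (\<lambda>g\<in>indices n. (\<mu> ((g - 1) mod int n) + 1) mod int n)"

definition shift_orbit :: "nat \<Rightarrow> (int \<Rightarrow> int) \<Rightarrow> (int \<Rightarrow> int) set" where
  "shift_orbit n \<mu> = {(shift_matching n ^^ t) \<mu> | t. t < n}"

definition mu_star :: "nat \<Rightarrow> int \<Rightarrow> int" where
  "mu_star n = (\<lambda>i\<in>indices n.
     let m = int n div 2 in if i < m then i else if i = m then int n - 1 else i - 1)"

lemma bij_betw_indicesI:
  assumes "inj_on f (indices n)" "f ` indices n \<subseteq> indices n"
  shows "bij_betw f (indices n) (indices n)"
  using assms endo_inj_surj[of "indices n" f] by (simp add: bij_betw_def)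

lemma bij_betw_add_mod:
  "bij_betw (\<lambda>g. (g + c) mod int n) (indices n) (indices n)"
proof (rule bij_betw_indicesI)
  show "inj_on (\<lambda>g. (g + c) mod int n) (indices n)"
  proof (rule inj_onI)
    fix x y assume xy: "x \<in> indices n" "y \<in> indices n" "(x + c) mod int n = (y + c) mod int n"
    then have "((x + c) - c) mod int n = ((y + c) - c) mod int n"
      by (intro mod_diff_cong refl) simp
    with xy show "x = y" by simp
  qed
qed auto

lemma complete_matching_mu_star: "complete_matching n (mu_star n)"
  unfolding complete_matching_def
proof (intro conjI bij_betw_indicesI)
  show "inj_on (mu_star n) (indices n)"
    by (rule inj_onI) (auto simp: mu_star_def Let_def split: if_splits)
qed (auto simp: mu_star_def Let_def)

lemma complete_matching_shift:
  assumes "complete_matching n \<mu>"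
  shows "complete_matching n (shift_matching n \<mu>)"
proof -
  have "bij_betw ((\<lambda>g. (g + 1) mod int n) \<circ> (\<mu> \<circ> (\<lambda>g. (g + (- 1)) mod int n)))
          (indices n) (indices n)"
    using assms unfolding complete_matching_def
    by (intro bij_betw_trans[OF bij_betw_trans[OF bij_betw_add_mod] bij_betw_add_mod]) simp
  moreover have "bij_betw (shift_matching n \<mu>) (indices n) (indices n) \<longleftrightarrow> bij_betw
          ((\<lambda>g. (g + 1) mod int n) \<circ> (\<mu> \<circ> (\<lambda>g. (g + (- 1)) mod int n))) (indices n) (indices n)"
    by (rule bij_betw_cong) (simp add: shift_matching_def)
  ultimately show ?thesis by (simp add: complete_matching_def shift_matching_def)
qed

lemma shift_orbit_complete_matching:
  assumes "complete_matching n \<mu>" "\<nu> \<in> shift_orbit n \<mu>"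
  shows "complete_matching n \<nu>"
proof -
  have "complete_matching n ((shift_matching n ^^ t) \<mu>)" for t
    by (induction t) (auto simp: assms(1) complete_matching_shift)
  with assms(2) show ?thesis by (auto simp: shift_orbit_def)
qed

lemma funpow_shift_matching:
  assumes "complete_matching n \<mu>" "g \<in> indices n"
  shows "(shift_matching n ^^ t) \<mu> g = (\<mu> ((g - int t) mod int n) + int t) mod int n"
  using assms(2)
proof (induction t arbitrary: g)
  case 0
  have "\<mu> g \<in> indices n" using assms(1) 0 by (auto simp: complete_matching_def bij_betw_def)
  with 0 show ?case by simp
next
  case (Suc t)
  then have "(g - 1) mod int n \<in> indices n" by auto
  from Suc.IH[OF this]
  have "(shift_matching n ^^ Suc t) \<mu> g =
      ((\<mu> (((g - 1) mod int n - int t) mod int n) + int t) mod int n + 1) mod int n"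
    using Suc.prems unfolding funpow.simps o_apply
    by (subst shift_matching_def) simp
  also have "((g - 1) mod int n - int t) mod int n = (g - int (Suc t)) mod int n"
    by (simp add: mod_diff_left_eq diff_diff_eq)
  also have "((\<mu> \<dots> + int t) mod int n + 1) mod int n = (\<mu> \<dots> + int (Suc t)) mod int n"
    by (simp only: mod_add_left_eq of_nat_Suc add.assoc add.commute[of 1])
  finally show ?case .
qed

lemma finite_shift_orbit: "finite (shift_orbit n \<mu>)"
  by (simp add: shift_orbit_def)

lemma shift_orbit_nonempty: "n \<ge> 1 \<Longrightarrow> shift_orbit n \<mu> \<noteq> {}"
  by (auto simp: shift_orbit_def intro!: exI[of _ 0])

end

theory Submission
  imports Defs
begin

text \<open>
  The ranks in the cyclic Hollow-Shell depend only on the cyclic distance \<open>(h - g) mod n\<close>, which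
  the shift preserves; hence the blocking count is constant on a shift orbit and only \<open>mu_star n\<close>
  has to be examined. A pair blocks a matching iff its distance is smaller than that between the
  man and his partner and larger than that between the woman and her partner. In \<open>mu_star n\<close> the
  men below \<open>m\<close> are at distance \<open>0\<close> from their partners, man \<open>m\<close> is at distance \<open>n - 1 - m\<close>, and
  the men above \<open>m\<close> are at distance \<open>n - 1\<close>, so that the blocking pairs are exactly the men above
  \<open>m\<close> with the women below \<open>m\<close>: there are \<open>m * (n - 1 - m)\<close> of them.
\<close>

text \<open>The shift carries couples of the matching to couples of its shift, for men and for women
  alike, and the two rank functions do not notice the shift.\<close>

lemma blocks_shift_matching_iff:
  assumes cm: "complete_matching n \<mu>"
    and rM: "\<And>g h. rM ((g + 1) mod int n) ((h + 1) mod int n) = rM g h"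
    and rW: "\<And>h g. rW ((h + 1) mod int n) ((g + 1) mod int n) = rW h g"
    and g: "g \<in> indices n" and h: "h \<in> indices n"
  shows "blocks n rM rW (shift_matching n \<mu>) ((g + 1) mod int n) ((h + 1) mod int n)
           \<longleftrightarrow> blocks n rM rW \<mu> g h"
proof -
  have shift: "shift_matching n \<mu> ((k + 1) mod int n) = (\<mu> k + 1) mod int n"
    if "k \<in> indices n" for k
    using that by (auto simp: shift_matching_def mod_diff_left_eq)
  have bij: "bij_betw \<mu> (indices n) (indices n)"
    and bij': "bij_betw (shift_matching n \<mu>) (indices n) (indices n)"
    using cm complete_matching_shift[OF cm] by (auto simp: complete_matching_def)
  define k where "k = inv_into (indices n) \<mu> h"
  have k: "k \<in> indices n" "\<mu> k = h"
    using bij_betw_apply[OF bij_betw_inv_into[OF bij] h] bij_betw_inv_into_right[OF bij h]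
    by (simp_all add: k_def)
  have "inv_into (indices n) (shift_matching n \<mu>) ((h + 1) mod int n) = (k + 1) mod int n"
    using bij' k by (intro inv_into_f_eq) (auto simp: bij_betw_def shift)
  then show ?thesis
    using g by (simp add: blocks_def shift rM rW k_def)
qed

lemma blocking_count_shift_matching:
  assumes cm: "complete_matching n \<mu>"
    and rM: "\<And>g h. rM ((g + 1) mod int n) ((h + 1) mod int n) = rM g h"
    and rW: "\<And>h g. rW ((h + 1) mod int n) ((g + 1) mod int n) = rW h g"
  shows "blocking_count n rM rW (shift_matching n \<mu>) = blocking_count n rM rW \<mu>"
proof -
  let ?s = "\<lambda>g. (g + 1) mod int n"
  let ?I = "indices n \<times> indices n"
  have "bij_betw (map_prod ?s ?s) ?I ?I"
    by (intro bij_betw_map_prod bij_betw_add_mod)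
  then have "bij_betw (map_prod ?s ?s) {p \<in> ?I. case_prod (blocks n rM rW \<mu>) p}
      {p \<in> ?I. case_prod (blocks n rM rW (shift_matching n \<mu>)) p}"
    by (rule bij_betw_Collect) (auto simp: blocks_shift_matching_iff[where rM = rM and rW = rW, OF cm rM rW])
  from bij_betw_same_card[OF this] show ?thesis
    by (simp add: blocking_count_def case_prod_unfold mem_Times_iff conj_assoc)
qed

lemma blocking_count_shift_orbit:
  assumes cm: "complete_matching n \<mu>"
    and rM: "\<And>g h. rM ((g + 1) mod int n) ((h + 1) mod int n) = rM g h"
    and rW: "\<And>h g. rW ((h + 1) mod int n) ((g + 1) mod int n) = rW h g"
    and "\<nu> \<in> shift_orbit n \<mu>"
  shows "blocking_count n rM rW \<nu> = blocking_count n rM rW \<mu>"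
proof -
  have "complete_matching n ((shift_matching n ^^ t) \<mu>)
      \<and> blocking_count n rM rW ((shift_matching n ^^ t) \<mu>) = blocking_count n rM rW \<mu>" for t
    by (induction t)
      (simp_all add: cm complete_matching_shift blocking_count_shift_matching[where rM = rM and rW = rW, OF _ rM rW])
  with assms(4) show ?thesis by (auto simp: shift_orbit_def)
qed

lemma diff_mod_shift:
  "((h + 1) mod int n - (g + 1) mod int n) mod int n = (h - g) mod int n"
  by (simp add: mod_diff_eq)

text \<open>Replaces \<open>mod\<close> by a case split, which makes the comparison of distances
  linear arithmetic.\<close>

lemma diff_mod_indices:
  assumes "g \<in> indices n" "h \<in> indices n"
  shows "(h - g) mod int n = (if g \<le> h then h - g else h - g + int n)"
proof (cases "g \<le> h")
  case False
  then have "(h - g + int n) mod int n = h - g + int n"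
    using assms by (intro mod_pos_pos_trivial) auto
  with False show ?thesis by simp
qed (use assms in auto)

lemma inv_into_mu_star:
  assumes "h \<in> indices n"
  shows "inv_into (indices n) (mu_star n) h =
    (let m = int n div 2 in if h < m then h else if h = int n - 1 then m else h + 1)"
  using complete_matching_mu_star[of n] assms
  by (intro inv_into_f_eq) (auto simp: complete_matching_def bij_betw_def mu_star_def Let_def)

text \<open>Man \<open>m\<close> blocks with nobody: the women nearer to him than his partner are
  those from \<open>m\<close> to \<open>n - 2\<close>, and they are already at the maximal distance
  \<open>n - 1\<close>. Woman \<open>n - 1\<close> blocks with nobody either: only men below
  \<open>m\<close> are farther from her than man \<open>m\<close>, and they are at distance
  \<open>0\<close> from their partners.\<close>

lemma blocks_mu_star_iff:
  assumes "g \<in> indices n" "h \<in> indices n"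
  shows "blocks n (hollow_shell_rM n) (hollow_shell_rW n) (mu_star n) g h
    \<longleftrightarrow> int n div 2 < g \<and> h < int n div 2"
proof -
  define m where "m = int n div 2"
  have m: "0 \<le> m" "2 * m \<le> int n" "int n \<le> 2 * m + 1"
    by (auto simp: m_def)
  have "mu_star n g \<in> indices n" "inv_into (indices n) (mu_star n) h \<in> indices n"
    using complete_matching_mu_star[of n] assms unfolding complete_matching_def
    by (blast intro: bij_betw_apply bij_betw_inv_into)+
  then show ?thesis
    unfolding blocks_def hollow_shell_rM_def hollow_shell_rW_def
    using assms m inv_into_mu_star[OF assms(2)]
    by (simp add: diff_mod_indices) (auto simp: mu_star_def Let_def m_def[symmetric])
qed

lemma blocking_count_mu_star:
  "blocking_count n (hollow_shell_rM n) (hollow_shell_rW n) (mu_star n)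
     = (n div 2) * (n - 1 - n div 2)"
proof -
  have "{(g, h). g \<in> indices n \<and> h \<in> indices n \<and>
      blocks n (hollow_shell_rM n) (hollow_shell_rW n) (mu_star n) g h}
    = {int n div 2<..<int n} \<times> {0..<int n div 2}"
    using blocks_mu_star_iff[of _ n] by auto
  moreover have "nat (int n - (int n div 2 + 1)) = n - 1 - n div 2" "nat (int n div 2) = n div 2"
    by linarith+
  ultimately show ?thesis
    by (simp add: blocking_count_def card_cartesian_product)
qed

text \<open>Passing from \<open>n\<close> to \<open>n + 2\<close> adds a zero term at each end and
  raises each of the \<open>n\<close> inner terms by 1, hence induction in steps of two.\<close>

lemma sum_min_complement:
  "(\<Sum>d<n. min (int d) (int n - 1 - int d)) = int ((n div 2) * (n - 1 - n div 2))"
proof (induction n rule: induct_nat_012)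
  case (ge2 n)
  have "(\<Sum>d<Suc (Suc n). min (int d) (int (Suc (Suc n)) - 1 - int d))
      = (\<Sum>d<n. min (int d) (int n - 1 - int d) + 1)"
    unfolding sum.lessThan_Suc_shift[of _ "Suc n"] sum.lessThan_Suc[of _ n]
    by (auto intro!: sum.cong)
  also have "\<dots> = int ((n div 2) * (n - 1 - n div 2)) + int n"
    by (simp add: sum.distrib ge2.IH(1))
  also have "\<dots> = int ((Suc (Suc n) div 2) * (Suc (Suc n) - 1 - Suc (Suc n) div 2))"
    by (cases "even n") (auto elim!: evenE oddE simp: algebra_simps of_nat_diff)
  finally show ?case .
qed auto

text \<open>For \<open>n = 2 * k\<close> the quotient is \<open>k * (k - 1) + 1/4\<close>; for
  \<open>n = 2 * k + 1\<close> it is exactly \<open>k * k\<close>.\<close>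

lemma floor_square_quarter:
  assumes "n \<ge> 1"
  shows "\<lfloor>(real n - 1)\<^sup>2 / 4\<rfloor> = int ((n div 2) * (n - 1 - n div 2))"
proof (cases "even n")
  case True
  then obtain k where "n = 2 * k" by (elim evenE)
  with assms show ?thesis
    by (intro floor_unique) (auto simp: of_nat_diff power2_eq_square field_simps)
next
  case False
  then obtain k where "n = 2 * k + 1" by (elim oddE)
  then show ?thesis
    by (intro floor_unique) (auto simp: power2_eq_square)
qed

lemma sum_min_rank_complements:
  "(\<Sum>i\<in>indices n. \<Sum>j\<in>indices n.
      min (man_complement n (hollow_shell_rM n) i j) (woman_complement n (hollow_shell_rW n) i j))
    = int n * int ((n div 2) * (n - 1 - n div 2))"
proof -
  let ?f = "\<lambda>d. min d (int n - 1 - d)"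
  have "(\<Sum>j\<in>indices n. min (man_complement n (hollow_shell_rM n) i j)
        (woman_complement n (hollow_shell_rW n) i j))
      = int ((n div 2) * (n - 1 - n div 2))" for i
  proof -
    \<comment> \<open>With \<open>d = (j - i) mod n\<close> the complements are
      \<open>n - 1 - d\<close> and \<open>d\<close>, so every row is a cyclic rearrangement of the
      same values.\<close>
    have "(\<Sum>j\<in>indices n. min (man_complement n (hollow_shell_rM n) i j)
        (woman_complement n (hollow_shell_rW n) i j))
        = (\<Sum>j\<in>indices n. ?f ((j + (- i)) mod int n))"
      by (intro sum.cong) (auto simp: man_complement_def woman_complement_def
          hollow_shell_rM_def hollow_shell_rW_def)
    also have "\<dots> = (\<Sum>d\<in>indices n. ?f d)"
      by (rule sum.reindex_bij_betw[OF bij_betw_add_mod])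
    also have "\<dots> = (\<Sum>d<n. ?f (int d))"
      by (rule sum.reindex_bij_witness[of _ int nat]) auto
    finally show ?thesis by (simp only: sum_min_complement)
  qed
  then show ?thesis by simp
qed

theorem proposition7p1:
  fixes n :: nat
  assumes "n \<ge> 1"
  shows "measure_pmf.expectation (pmf_of_set (shift_orbit n (mu_star n)))
           (\<lambda>\<mu>. real (blocking_count n (hollow_shell_rM n) (hollow_shell_rW n) \<mu>))
         = real_of_int \<lfloor>(real n - 1)\<^sup>2 / 4\<rfloor>
       \<and> real_of_int \<lfloor>(real n - 1)\<^sup>2 / 4\<rfloor>
         = 1 / real n * (\<Sum>i\<in>indices n. \<Sum>j\<in>indices n.
             real_of_int (min (man_complement n (hollow_shell_rM n) i j)
                              (woman_complement n (hollow_shell_rW n) i j)))"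
proof
  let ?O = "shift_orbit n (mu_star n)"
  have "blocking_count n (hollow_shell_rM n) (hollow_shell_rW n) \<nu>
      = (n div 2) * (n - 1 - n div 2)" if "\<nu> \<in> ?O" for \<nu>
    using blocking_count_shift_orbit[OF complete_matching_mu_star _ _ that]
    by (simp add: hollow_shell_rM_def hollow_shell_rW_def diff_mod_shift blocking_count_mu_star)
  \<comment> \<open>The count is constant on the orbit, so its mean is that constant whatever the
    size of the orbit.\<close>
  then show "measure_pmf.expectation (pmf_of_set ?O)
      (\<lambda>\<mu>. real (blocking_count n (hollow_shell_rM n) (hollow_shell_rW n) \<mu>))
    = real_of_int \<lfloor>(real n - 1)\<^sup>2 / 4\<rfloor>"
    using finite_shift_orbit[of n] shift_orbit_nonempty[OF assms]
    by (simp add: integral_pmf_of_set floor_square_quarter[OF assms])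
next
  show "real_of_int \<lfloor>(real n - 1)\<^sup>2 / 4\<rfloor>
    = 1 / real n * (\<Sum>i\<in>indices n. \<Sum>j\<in>indices n.
        real_of_int (min (man_complement n (hollow_shell_rM n) i j)
                         (woman_complement n (hollow_shell_rW n) i j)))"
    using assms unfolding of_int_sum[symmetric] sum_min_rank_complements
    by (simp add: floor_square_quarter)
qed

end
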